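(* Let $G$ be a finite $\mathrm{CA}$-group which is $m$-centralizer, where $m=|G|/|Z(G)|$. Then there exists an integer $r>1$ such that $m=2^r$. Conversely, for an arbitrary integer $r>1$, there exists a finite $\mathrm{CA}$-group $G$ which is $2^r$-centralizer.
   Context: All groups are finite. $Z(G)$ is the center of $G$, $C_G(x)$ is the centralizer of $x$ in $G$, and $\mathrm{Cent}(G)=\{C_G(x): x\in G\}$. A group $G$ is called $n$-centralizer if $|\mathrm{Cent}(G)|=n$. A non-abelian group $G$ is called a $\mathrm{CA}$-group if $C_G(x)$ is abelian for all $x\in G\setminus Z(G)$. *)

theory Defs
  imports "HOL-Algebra.Coset"
begin

definition group_center :: "('a, 'b) monoid_scheme \<Rightarrow> 'a set" where
  "group_center G = {z \<in> carrier G. \<forall>y \<in> carrier G. z \<otimes>\<^bsub>G\<^esub> y = y \<otimes>\<^bsub>G\<^esub> z}"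

definition centralizer :: "('a, 'b) monoid_scheme \<Rightarrow> 'a \<Rightarrow> 'a set" where
  "centralizer G x = {y \<in> carrier G. x \<otimes>\<^bsub>G\<^esub> y = y \<otimes>\<^bsub>G\<^esub> x}"

definition Cent :: "('a, 'b) monoid_scheme \<Rightarrow> 'a set set" where
  "Cent G = centralizer G ` carrier G"

definition n_centralizer :: "nat \<Rightarrow> ('a, 'b) monoid_scheme \<Rightarrow> bool" where
  "n_centralizer n G \<longleftrightarrow> card (Cent G) = n"

definition CA_group :: "('a, 'b) monoid_scheme \<Rightarrow> bool" where
  "CA_group G \<longleftrightarrow> group G \<and> \<not> comm_group G \<and>
     (\<forall>x \<in> carrier G - group_center G. comm_group (G\<lparr>carrier := centralizer G x\<rparr>))"

lemma (in group) subgroup_centralizer: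
  assumes x: "x \<in> carrier G"
  shows "subgroup (centralizer G x) G"
proof (rule subgroupI)
  show "centralizer G x \<subseteq> carrier G"
    by (auto simp: centralizer_def)
  show "centralizer G x \<noteq> {}"
    using x by (auto simp: centralizer_def)
next
  fix a assume "a \<in> centralizer G x"
  then have a: "a \<in> carrier G" "x \<otimes> a = a \<otimes> x"
    by (auto simp: centralizer_def)
  then have "x = a \<otimes> x \<otimes> inv a"
    using x by (metis inv_solve_right' m_closed)
  then have "x \<otimes> inv a = inv a \<otimes> x"
    using x a by (metis inv_closed inv_solve_left m_assoc m_closed)
  then show "inv a \<in> centralizer G x"
    using a by (simp add: centralizer_def)
next
  fix a b assume "a \<in> centralizer G x" "b \<in> centralizer G x"
  then show "a \<otimes> b \<in> centralizer G x"
    using x by (auto simp: centralizer_def) (metis m_assoc)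
qed

lemma (in group) group_center_eq_Inter:
  "group_center G = (\<Inter>x \<in> carrier G. centralizer G x)"
  by (fastforce simp: group_center_def centralizer_def)

lemma (in group) subgroup_group_center: "subgroup (group_center G) G"
  unfolding group_center_eq_Inter
  by (rule subgroups_Inter) (use subgroup_centralizer in auto)

(* The quotient "order G div card (group_center G)" is exact. *)
lemma (in group) card_group_center_dvd_order: "card (group_center G) dvd order G"
  using lagrange[OF subgroup_group_center] by (metis dvd_triv_right)

end

theory Submission
  imports Defs "HOL-Algebra.Sylow" "HOL-Algebra.Multiplicative_Group"
begin

text \<open>
  For the first half, \<open>x \<mapsto> C(x)\<close> factors through \<open>G/Z\<close>, so \<open>m\<close> centralizers make the
  induced map on \<open>G/Z\<close> injective. As \<open>C(x) = C(x\<^sup>-\<^sup>1)\<close>, every square is central, and \<open>G/Z\<close>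
  has exponent 2. Two non-commuting elements give three centralizers, whence \<open>r > 1\<close>.
  For the second half, the dihedral group of order \<open>4k\<close> has \<open>k + 2\<close> centralizers;
  take \<open>k = 2\<^sup>r - 2\<close>.
\<close>

section \<open>Finite groups in which every square is trivial\<close>

lemma power_of_unique_prime_divisor:
  fixes n p :: nat
  assumes "n > 0" "prime p" "\<And>q. prime q \<Longrightarrow> q dvd n \<Longrightarrow> q = p"
  shows "\<exists>r. n = p ^ r"
proof -
  obtain k where k: "n = p ^ multiplicity p n * k" "\<not> p dvd k"
    using multiplicity_decompose'[of n p] assms(1,2) not_prime_unit[of p] by blast
  have "k = 1"
    using k assms(3) prime_factor_nat[of k] by (metis dvd_mult)
  then show ?thesis using k(1) by auto
qed

text \<open>A prime \<open>q\<close> dividing the order yields a subgroup of order \<open>q\<close>.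
  A nontrivial \<open>x\<close> in it satisfies both \<open>x [^] q = \<one>\<close> and
  \<open>x [^] 2 = \<one>\<close>, which forces \<open>q = 2\<close>.\<close>

lemma (in group) order_exponent_two:
  assumes fin: "finite (carrier G)" and sq: "\<And>x. x \<in> carrier G \<Longrightarrow> x \<otimes> x = \<one>"
  shows "\<exists>r. order G = 2 ^ r"
proof (rule power_of_unique_prime_divisor)
  show "order G > 0"
    using fin by (simp add: order_gt_0_iff_finite)
next
  fix q assume q: "prime q" "q dvd order G"
  \<comment> \<open>With exponent 1, Sylow's theorem serves as Cauchy's theorem; \<open>k\<close>
    may still be divisible by \<open>q\<close>.\<close>
  then obtain k where "order G = q ^ 1 * k" by (auto elim: dvdE)
  from sylow_thm[OF q(1) is_group this fin]
  obtain H where H: "subgroup H G" "card H = q" by auto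
  interpret H: subgroup H G by fact
  interpret GH: group "G\<lparr>carrier := H\<rparr>" by (rule H.subgroup_is_group) (rule is_group)
  have "H \<noteq> {\<one>}" using H(2) q(1) by auto
  then obtain x where x: "x \<in> H" "x \<noteq> \<one>"
    using H.one_closed by blast
  have xc: "x \<in> carrier G" using x by simp
  have "x [^] q = \<one>"
    using GH.pow_order_eq_1[of x] x H(2) by (simp add: order_def flip: nat_pow_consistent)
  moreover have "x [^] (2 * k) = \<one>" for k :: nat
  proof -
    have "x [^] (2 * k) = (x [^] (2 :: nat)) [^] k" using xc by (simp add: nat_pow_pow)
    also have "x [^] (2 :: nat) = \<one>" using sq[OF xc] xc by (simp add: numeral_2_eq_2)
    finally show ?thesis by simp
  qed
  \<comment> \<open>For odd \<open>q\<close> the even part of the exponent contributes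
    \<open>\<one>\<close>, leaving \<open>x [^] q = x\<close>.\<close>
  ultimately have "even q"
    using x(2) xc by (metis oddE nat_pow_Suc Suc_eq_plus1 l_one)
  then show "q = 2" using q(1) by (metis primes_dvd_imp_eq two_is_prime_nat)
qed simp

section \<open>Centralizers as a function on the cosets of the center\<close>

lemma (in group) normal_group_center: "group_center G \<lhd> G"
proof -
  have "x \<otimes> z \<otimes> inv x = z" if "x \<in> carrier G" "z \<in> group_center G" for x z
    using that by (metis (mono_tags, lifting) group_center_def inv_solve_right' m_closed mem_Collect_eq)
  then show ?thesis
    using subgroup_group_center by (simp add: normal_inv_iff)
qed

lemma (in group) centralizer_inv:
  assumes "x \<in> carrier G"
  shows "centralizer G (inv x) = centralizer G x"
proof -
  have "centralizer G x \<subseteq> centralizer G (inv x)" if "x \<in> carrier G" for x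
    using that unfolding centralizer_def
    by (auto simp: inv_solve_left inv_solve_right' m_assoc[symmetric])
      (metis inv_solve_right' inv_solve_left m_assoc m_closed inv_closed)
  from this[of x] this[of "inv x"] show ?thesis using assms by auto
qed

lemma (in group) centralizer_center_mult:
  assumes "z \<in> group_center G" "x \<in> carrier G"
  shows "centralizer G (z \<otimes> x) = centralizer G x"
proof -
  have "z \<otimes> x \<otimes> y = y \<otimes> (z \<otimes> x) \<longleftrightarrow> x \<otimes> y = y \<otimes> x" if "y \<in> carrier G" for y
  proof -
    have "y \<otimes> (z \<otimes> x) = z \<otimes> (y \<otimes> x)"
      using assms that by (simp add: group_center_def m_assoc)
    moreover have "z \<otimes> x \<otimes> y = z \<otimes> (x \<otimes> y)"
      using assms that by (simp add: group_center_def m_assoc)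
    ultimately show ?thesis
      using assms that by (simp add: group_center_def)
  qed
  then show ?thesis by (auto simp: centralizer_def)
qed

text \<open>All members of a central coset have the same centralizer, so the union merely extracts
  this common value without choosing a representative.\<close>

lemma (in group) Union_centralizer_center_coset:
  assumes "x \<in> carrier G"
  shows "\<Union> (centralizer G ` (group_center G #> x)) = centralizer G x"
  using assms centralizer_center_mult subgroup.one_closed[OF subgroup_group_center]
  by (auto simp: r_coset_def)

text \<open>This exhibits a surjection from \<open>G/Z\<close> onto \<open>Cent G\<close>; equal
  finite cardinalities will then make it injective.\<close>

lemma (in group) Cent_eq_image_rcosets:
  "Cent G = (\<lambda>U. \<Union> (centralizer G ` U)) ` (rcosets (group_center G))"
proof -
  have "(\<lambda>U. \<Union> (centralizer G ` U)) ` (rcosets (group_center G)) =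
      (\<lambda>x. \<Union> (centralizer G ` (group_center G #> x))) ` carrier G"
    by (auto simp: RCOSETS_def image_iff)
  also have "\<dots> = Cent G"
    unfolding Cent_def by (rule image_cong) (simp_all add: Union_centralizer_center_coset)
  finally show ?thesis by simp
qed

lemma (in group) card_rcosets_center:
  assumes "finite (carrier G)"
  shows "card (rcosets (group_center G)) = order G div card (group_center G)"
proof -
  have "finite (group_center G)" "group_center G \<noteq> {}"
    using assms subgroup.subset[OF subgroup_group_center] finite_subset
      subgroup.one_closed[OF subgroup_group_center] by auto
  then show ?thesis
    by (simp add: lagrange[OF subgroup_group_center, symmetric])
qed

lemma (in group) square_in_center:
  assumes fin: "finite (carrier G)"
    and card: "card (Cent G) = order G div card (group_center G)"
    and x: "x \<in> carrier G"
  shows "x \<otimes> x \<in> group_center G"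
proof -
  let ?Z = "group_center G"
  have "finite (rcosets ?Z)"
    using fin by (simp add: RCOSETS_def)
  then have inj: "inj_on (\<lambda>U. \<Union> (centralizer G ` U)) (rcosets ?Z)"
    using card card_rcosets_center[OF fin]
    by (intro eq_card_imp_inj_on) (simp_all add: Cent_eq_image_rcosets)
  \<comment> \<open>Both cosets are sent to the same centralizer, so injectivity identifies them.
    Then \<open>x = z \<otimes> inv x\<close> with \<open>z\<close> central, and \<open>z\<close> is
    the square of \<open>x\<close>.\<close>
  have "?Z #> inv x = ?Z #> x"
    by (rule inj_onD[OF inj])
      (use x in \<open>simp_all add: Union_centralizer_center_coset centralizer_inv rcosetsI subgroup.subset[OF subgroup_group_center]\<close>)
  then have "x \<in> ?Z #> inv x"
    using rcos_self[OF x subgroup_group_center] by simp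
  then obtain z where "z \<in> ?Z" "x = z \<otimes> inv x"
    by (auto simp: r_coset_def)
  then show ?thesis using x
    by (metis inv_solve_right inv_closed subgroup.mem_carrier[OF subgroup_group_center])
qed

lemma (in group) card_Cent_nonabelian:
  assumes fin: "finite (carrier G)" and nab: "\<not> comm_group G"
  shows "card (Cent G) > 2"
proof -
  obtain x y where xy: "x \<in> carrier G" "y \<in> carrier G" "x \<otimes> y \<noteq> y \<otimes> x"
    using nab group_comm_groupI by auto
  \<comment> \<open>The whole group is the centralizer of \<open>\<one>\<close>. It differs from the
    other two since \<open>x\<close> and \<open>y\<close> do not commute, and \<open>x\<close>
    separates these two.\<close>
  have "card {carrier G, centralizer G x, centralizer G y} = 3"
    using xy by (subst card_insert_disjoint | force simp: centralizer_def)+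
  moreover have "{carrier G, centralizer G x, centralizer G y} \<subseteq> Cent G"
    using xy by (auto simp: Cent_def centralizer_def intro!: image_eqI[of _ _ \<one>])
  moreover have "finite (Cent G)" using fin by (simp add: Cent_def)
  ultimately have "3 \<le> card (Cent G)" by (metis card_mono)
  then show ?thesis by simp
qed

lemma (in group) card_Cent_eq_index_center:
  assumes fin: "finite (carrier G)" and nab: "\<not> comm_group G"
    and card: "card (Cent G) = order G div card (group_center G)"
  shows "\<exists>r>1. card (Cent G) = 2 ^ r"
proof -
  let ?Z = "group_center G"
  interpret Z: normal ?Z G by (rule normal_group_center)
  interpret Q: group "G Mod ?Z" by (rule Z.factorgroup_is_group)
  \<comment> \<open>The square of the coset of \<open>x\<close> is the coset of
    \<open>x \<otimes> x\<close>, which is central.\<close>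
  have "U <#> U = ?Z" if U: "U \<in> rcosets ?Z" for U
  proof -
    obtain x where x: "x \<in> carrier G" "U = ?Z #> x"
      using U by (auto simp: RCOSETS_def)
    then show ?thesis
      using square_in_center[OF fin card] Z.rcos_sum Z.rcos_const by (simp add: is_group)
  qed
  then obtain r where "order (G Mod ?Z) = 2 ^ r"
    using Q.order_exponent_two fin by (auto simp: FactGroup_def RCOSETS_def)
  then have r: "card (Cent G) = 2 ^ r"
    using card card_rcosets_center[OF fin] by (simp add: FactGroup_def order_def)
  moreover have "r \<noteq> 0" "r \<noteq> 1"
    using card_Cent_nonabelian[OF fin nab] unfolding r by (auto intro: gr0I)
  ultimately show ?thesis by (intro exI[of _ r]) auto
qed

section \<open>The dihedral group of order 2n on an initial segment of the naturals\<close>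

text \<open>
  The residue \<open>i < n\<close> stands for the map \<open>t \<mapsto> t + i\<close> of the integers modulo \<open>n\<close>,
  and \<open>n + i\<close> stands for \<open>t \<mapsto> i - t\<close>.
\<close>

definition dihedral :: "nat \<Rightarrow> nat monoid" where
  "dihedral n = \<lparr>carrier = {..<2 * n},
     monoid.mult = (\<lambda>x y. nat ((if x < n then int x + int y else int x - int y) mod int n)
                    + (if x < n \<longleftrightarrow> y < n then 0 else n)),
     monoid.one = 0\<rparr>"

lemma carrier_dihedral [simp]: "carrier (dihedral n) = {..<2 * n}"
  and one_dihedral [simp]: "\<one>\<^bsub>dihedral n\<^esub> = 0"
  by (simp_all add: dihedral_def)

context
  fixes n :: nat
  assumes n: "n > 0"
begin

lemma mult_dihedral_less_iff: "x \<otimes>\<^bsub>dihedral n\<^esub> y < n \<longleftrightarrow> (x < n \<longleftrightarrow> y < n)"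
  using n by (auto simp: dihedral_def nat_less_iff)

lemma mult_dihedral_less: "x \<otimes>\<^bsub>dihedral n\<^esub> y < 2 * n"
proof -
  have "nat (i mod int n) + (if b then 0 else n) < 2 * n" for i b
  proof -
    have "nat (i mod int n) < n" using n by (simp add: nat_less_iff)
    then show ?thesis by simp
  qed
  then show ?thesis by (simp only: dihedral_def monoid.simps)
qed

lemma mult_dihedral_cong:
  "int (x \<otimes>\<^bsub>dihedral n\<^esub> y) mod int n = (if x < n then int x + int y else int x - int y) mod int n"
  using n by (simp add: dihedral_def)

text \<open>A reflection \<open>n + i\<close> is congruent to \<open>i\<close>, so an element is
  determined by its kind and its residue. Equations in the group thus become congruences of
  integers.\<close>

lemma dihedral_eq_iff:
  assumes "x < 2 * n" "y < 2 * n"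
  shows "x = y \<longleftrightarrow> (x < n \<longleftrightarrow> y < n) \<and> int x mod int n = int y mod int n"
proof -
  have *: "z mod n = (if z < n then z else z - n)" if "z < 2 * n" for z
    using that by (simp add: mod_if)
  show ?thesis
    using * assms by (auto simp: of_nat_mod[symmetric] split: if_splits)
qed

lemma group_dihedral: "group (dihedral n)"
proof (rule groupI)
  fix x y assume "x \<in> carrier (dihedral n)" "y \<in> carrier (dihedral n)"
  show "x \<otimes>\<^bsub>dihedral n\<^esub> y \<in> carrier (dihedral n)" by (simp add: mult_dihedral_less)
next
  show "\<one>\<^bsub>dihedral n\<^esub> \<in> carrier (dihedral n)" using n by simp
next
  fix x y z assume "x \<in> carrier (dihedral n)" "y \<in> carrier (dihedral n)" "z \<in> carrier (dihedral n)"
  \<comment> \<open>An inner product is known only through its residue. \<open>cong\<close>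
    substitutes that residue in the right factor, \<open>cong'\<close> in the left one.\<close>
  have cong: "(if x < n then int x + a else int x - a) mod int n
      = (if x < n then int x + b else int x - b) mod int n"
    if "a mod int n = b mod int n" for a b x
    by (simp add: mod_add_cong[OF refl that] mod_diff_cong[OF refl that])
  have cong': "(if P then a + c else a - c) mod int n = (if P then b + c else b - c) mod int n"
    if "a mod int n = b mod int n" for a b c P
    by (simp add: mod_add_cong[OF that refl] mod_diff_cong[OF that refl])
  show "x \<otimes>\<^bsub>dihedral n\<^esub> y \<otimes>\<^bsub>dihedral n\<^esub> z = x \<otimes>\<^bsub>dihedral n\<^esub> (y \<otimes>\<^bsub>dihedral n\<^esub> z)"
    unfolding dihedral_eq_iff[OF mult_dihedral_less mult_dihedral_less]
      mult_dihedral_less_iff mult_dihedral_cong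
      cong[OF mult_dihedral_cong] cong'[OF mult_dihedral_cong]
    by (auto simp: algebra_simps)
next
  fix x assume "x \<in> carrier (dihedral n)"
  then have x: "x < 2 * n" by simp
  show "\<one>\<^bsub>dihedral n\<^esub> \<otimes>\<^bsub>dihedral n\<^esub> x = x"
    using x n
    by (subst dihedral_eq_iff)
      (simp_all add: mult_dihedral_less mult_dihedral_less_iff mult_dihedral_cong)
  show "\<exists>y\<in>carrier (dihedral n). y \<otimes>\<^bsub>dihedral n\<^esub> x = \<one>\<^bsub>dihedral n\<^esub>"
  proof (rule bexI)
    \<comment> \<open>Reflections are involutions. The outer \<open>mod n\<close> matters at
      \<open>x = 0\<close>, where \<open>n - x\<close> would be a reflection.\<close>
    let ?y = "if x < n then (n - x) mod n else x"
    show "?y \<in> carrier (dihedral n)"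
      using x n by (auto intro: less_trans[OF mod_less_divisor])
    have "?y < n \<longleftrightarrow> x < n" using n by simp
    moreover have "(int ((n - x) mod n) + int x) mod int n = 0" if "x < n"
      using that by (simp add: of_nat_mod mod_add_left_eq of_nat_diff)
    ultimately show "?y \<otimes>\<^bsub>dihedral n\<^esub> x = \<one>\<^bsub>dihedral n\<^esub>"
      using x n
      by (subst dihedral_eq_iff)
        (auto simp: mult_dihedral_less mult_dihedral_less_iff mult_dihedral_cong)
  qed
qed

end

section \<open>Commutation and centralizers in the dihedral group of order 4k\<close>

text \<open>Modulo \<open>2 * k\<close>, a rotation \<open>x\<close> commutes with a reflection
  exactly when \<open>2 * x\<close> vanishes, and two reflections commute exactly when twice their
  difference vanishes. Cancelling 2 leaves conditions modulo \<open>k\<close>.\<close>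

lemma dihedral_commute_iff:
  fixes k :: nat
  defines "D \<equiv> dihedral (2 * k)"
  assumes k: "k > 0" and x: "x \<in> carrier D" and y: "y \<in> carrier D"
  shows "x \<otimes>\<^bsub>D\<^esub> y = y \<otimes>\<^bsub>D\<^esub> x \<longleftrightarrow>
    x \<in> {0, k} \<or> y \<in> {0, k} \<or> x < 2 * k \<and> y < 2 * k \<or>
    2 * k \<le> x \<and> 2 * k \<le> y \<and> x mod k = y mod k"
proof -
  have n: "2 * k > 0" using k by simp
  note eq = dihedral_eq_iff[OF n mult_dihedral_less[OF n] mult_dihedral_less[OF n],
      unfolded mult_dihedral_less_iff[OF n] mult_dihedral_cong[OF n]]
  have dbl: "2 * int k dvd 2 * i \<longleftrightarrow> int k dvd i" for i by simp
  have rot: "int k dvd int z \<longleftrightarrow> z \<in> {0, k}" if "z < 2 * k" for z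
  proof -
    have "z mod k = (if z < k then z else z - k)" using that by (simp add: mod_if)
    then show ?thesis using k that unfolding int_dvd_int_iff dvd_eq_mod_eq_0 by (auto split: if_splits)
  qed
  \<comment> \<open>\<open>neg\<close> compares the two products of a rotation \<open>a\<close> with
    a reflection \<open>b\<close>; \<open>refl\<close> does so for two reflections.\<close>
  have neg: "(a + b) mod (2 * int k) = (b - a) mod (2 * int k) \<longleftrightarrow> int k dvd a" for a b
    unfolding mod_eq_dvd_iff using dbl[of a] by (simp add: algebra_simps)
  have refl: "(a - b) mod (2 * int k) = (b - a) mod (2 * int k) \<longleftrightarrow> a mod int k = b mod int k" for a b
    unfolding mod_eq_dvd_iff using dbl[of "a - b"] by (simp add: algebra_simps)
  consider "x < 2 * k" "y < 2 * k" | "x < 2 * k" "2 * k \<le> y" | "2 * k \<le> x" "y < 2 * k"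
    | "2 * k \<le> x" "2 * k \<le> y" by linarith
  then show ?thesis
  proof cases
    case 1
    then show ?thesis unfolding D_def eq by (simp add: add.commute)
  next
    case 2
    then show ?thesis using rot[of x] neg[of "int x" "int y"] k unfolding D_def eq by auto
  next
    case 3
    then show ?thesis using rot[of y] neg[of "int y" "int x"] k unfolding D_def eq
      by (auto simp: add.commute)
  next
    case 4
    then show ?thesis using refl[of "int x" "int y"] k unfolding D_def eq
      by (auto simp: of_nat_mod[symmetric])
  qed
qed

context
  fixes k :: nat
  assumes k: "k > 1"
begin

lemma group_center_dihedral: "group_center (dihedral (2 * k)) = {0, k}"
proof (intro equalityI subsetI)
  fix x assume "x \<in> {0, k}"
  then show "x \<in> group_center (dihedral (2 * k))"
    using k unfolding group_center_def by (auto simp: dihedral_commute_iff)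
next
  fix x assume "x \<in> group_center (dihedral (2 * k))"
  then have x: "x < 4 * k"
    and "\<And>y. y < 4 * k \<Longrightarrow> x \<otimes>\<^bsub>dihedral (2 * k)\<^esub> y = y \<otimes>\<^bsub>dihedral (2 * k)\<^esub> x"
    by (auto simp: group_center_def)
  \<comment> \<open>Commuting with the rotation 1, noncentral as \<open>k > 1\<close>, excludes
    reflections; commuting with the reflection \<open>2 * k\<close> then leaves only 0 and
    \<open>k\<close>.\<close>
  from this(2)[of 1] this(2)[of "2 * k"] show "x \<in> {0, k}"
    using k x by (auto simp: dihedral_commute_iff)
qed

text \<open>The centralizer of a noncentral \<open>x\<close> consists of the rotations, or of the
  center and the reflections congruent to \<open>x\<close> modulo \<open>k\<close>. Either set
  commutes elementwise.\<close>

lemma CA_group_dihedral: "CA_group (dihedral (2 * k))"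
proof -
  let ?D = "dihedral (2 * k)"
  interpret D: group ?D by (rule group_dihedral) (use k in simp)
  have "\<not> comm_group ?D"
  proof
    assume "comm_group ?D"
    then interpret C: comm_group ?D .
    show False using C.m_comm[of 1 "2 * k"] k by (simp add: dihedral_commute_iff)
  qed
  moreover have "comm_group (?D\<lparr>carrier := centralizer ?D x\<rparr>)"
    if x: "x \<in> carrier ?D - group_center ?D" for x
  proof (rule group.group_comm_groupI)
    show "group (?D\<lparr>carrier := centralizer ?D x\<rparr>)"
      using x by (intro subgroup.subgroup_is_group D.subgroup_centralizer D.is_group) auto
    show "y \<otimes>\<^bsub>?D\<lparr>carrier := centralizer ?D x\<rparr>\<^esub> z = z \<otimes>\<^bsub>?D\<lparr>carrier := centralizer ?D x\<rparr>\<^esub> y"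
      if "y \<in> carrier (?D\<lparr>carrier := centralizer ?D x\<rparr>)"
        "z \<in> carrier (?D\<lparr>carrier := centralizer ?D x\<rparr>)" for y z
      using that x k unfolding centralizer_def group_center_dihedral
      by (auto simp: dihedral_commute_iff)
  qed
  ultimately show ?thesis using D.is_group by (simp add: CA_group_def)
qed

lemma card_Cent_dihedral: "card (Cent (dihedral (2 * k))) = k + 2"
proof -
  let ?D = "dihedral (2 * k)"
  \<comment> \<open>For \<open>i < k\<close> this is the centralizer of the reflections
    \<open>2 * k + i\<close> and \<open>3 * k + i\<close>. The \<open>k\<close> sets
    \<open>R i\<close>, the whole group and the rotations make up the count
    \<open>k + 2\<close>.\<close>
  define R where "R i = {0, k} \<union> {y \<in> {2 * k..<4 * k}. y mod k = i}" for i
  have cent: "centralizer ?D x = (if x \<in> {0, k} then {..<4 * k} else if x < 2 * k then {..<2 * k}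
      else R (x mod k))" if "x < 4 * k" for x
    using that k unfolding centralizer_def R_def by (auto simp: dihedral_commute_iff)
  have R: "2 * k + i \<in> R j \<longleftrightarrow> i = j" if "i < k" for i j
    using that k by (auto simp: R_def)
  have "Cent ?D = {{..<4 * k}, {..<2 * k}} \<union> R ` {..<k}"
  proof (intro equalityI subsetI)
    fix C assume "C \<in> Cent ?D"
    then show "C \<in> {{..<4 * k}, {..<2 * k}} \<union> R ` {..<k}"
      using k by (auto simp: Cent_def cent)
  next
    have "{..<4 * k} = centralizer ?D 0" "{..<2 * k} = centralizer ?D 1"
      using k by (auto simp: cent)
    moreover have "R i = centralizer ?D (2 * k + i)" if "i < k" for i
      using that k by (simp add: cent)
    moreover fix C assume "C \<in> {{..<4 * k}, {..<2 * k}} \<union> R ` {..<k}"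
    ultimately show "C \<in> Cent ?D"
      using k by (fastforce simp: Cent_def)
  qed
  moreover have "inj_on R {..<k}"
    using R by (metis inj_onI lessThan_iff)
  moreover have "{{..<4 * k}, {..<2 * k}} \<inter> R ` {..<k} = {}"
  proof -
    \<comment> \<open>The noncentral rotation 1 separates every \<open>R i\<close> from the two
      larger centralizers.\<close>
    have "1 \<notin> R i" for i using k by (auto simp: R_def)
    moreover have "1 \<in> {..<4 * k}" "1 \<in> {..<2 * k}" using k by auto
    ultimately have "R i \<noteq> {..<4 * k}" "R i \<noteq> {..<2 * k}" for i by metis+
    then show ?thesis by blast
  qed
  moreover have "{..<4 * k} \<noteq> {..<2 * k}" using k by simp
  ultimately show ?thesis by (simp add: card_Un_disjoint card_image)
qed

end

theorem theorem5:
  shows "(\<forall>(G :: ('a, 'b) monoid_scheme) (m :: nat).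
            finite (carrier G) \<and> CA_group G \<and>
            m = order G div card (group_center G) \<and> n_centralizer m G
            \<longrightarrow> (\<exists>r :: nat. r > 1 \<and> m = 2 ^ r)) \<and>
         (\<forall>r :: nat. r > 1 \<longrightarrow>
            (\<exists>G :: nat monoid. finite (carrier G) \<and> CA_group G \<and> n_centralizer (2 ^ r) G))"
proof (intro conjI allI impI)
  fix G :: "('a, 'b) monoid_scheme" and m :: nat
  assume "finite (carrier G) \<and> CA_group G \<and>
    m = order G div card (group_center G) \<and> n_centralizer m G"
  then show "\<exists>r>1. m = 2 ^ r"
    using group.card_Cent_eq_index_center[of G] by (auto simp: CA_group_def n_centralizer_def)
next
  fix r :: nat assume "r > 1"
  \<comment> \<open>The bound makes \<open>2 ^ r - 2\<close> an untruncated subtraction with value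
    at least 2.\<close>
  then have "(2 :: nat) ^ 2 \<le> 2 ^ r" by (intro power_increasing) auto
  then have k: "(2 :: nat) ^ r - 2 > 1" "(2 :: nat) ^ r - 2 + 2 = 2 ^ r" by simp_all
  show "\<exists>G :: nat monoid. finite (carrier G) \<and> CA_group G \<and> n_centralizer (2 ^ r) G"
    using CA_group_dihedral[OF k(1)] card_Cent_dihedral[OF k(1)] k(2)
    by (intro exI[of _ "dihedral (2 * (2 ^ r - 2))"]) (simp add: n_centralizer_def)
qed

end
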